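(* Every co-Heyting algebra that is existentially closed in the class of all co-Heyting algebras satisfies the density axiom D1 and the splitting axiom S1.
   Context: A co-Heyting algebra is a bounded distributive lattice $(L,\mathbf{0},\mathbf{1},\vee,\wedge)$ with a binary operation $-$ such that $a-b$ is the least $c\in L$ with $a\le b\vee c$; it is regarded as a first-order structure in the language $\{\mathbf 0,\mathbf 1,\vee,\wedge,-\}$, and embeddings, subalgebras and extensions are taken in this language. For $a,b\in L$ write $b\ll a$ iff $a-b=a$ and $b\le a$. An algebra $L$ in a class $\mathcal V$ is existentially closed in $\mathcal V$ if every existential formula with parameters in $L$ that holds in some extension of $L$ belonging to $\mathcal V$ already holds in $L$. Axiom D1: for all $a,c$ with $c\ll a$ and $a\neq\mathbf 0$ there is $b\neq\mathbf 0$ with $c\ll b\ll a$. Axiom S1: for all $a,b_1,b_2$ with $b_1\vee b_2\ll a$ and $a\ne\mathbf 0$ there are non-zero $a_1,a_2$ with $a-a_2=a_1\ge b_1$, $a-a_1=a_2\ge b_2$, and $a_1\wedge a_2=b_1\wedge b_2$. *)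

theory Defs
  imports Main
begin

section \<open>Co-Heyting algebras\<close>

record 'a cha_structure =
  carrier :: "'a set"
  zero :: 'a (\<open>\<zero>\<index>\<close>)
  one :: 'a (\<open>\<one>\<index>\<close>)
  join :: "'a \<Rightarrow> 'a \<Rightarrow> 'a" (infixl \<open>\<squnion>\<index>\<close> 65)
  meet :: "'a \<Rightarrow> 'a \<Rightarrow> 'a" (infixl \<open>\<sqinter>\<index>\<close> 70)
  diff :: "'a \<Rightarrow> 'a \<Rightarrow> 'a" (infixl \<open>\<ominus>\<index>\<close> 65)

definition cha_le :: "('a, 'm) cha_structure_scheme \<Rightarrow> 'a \<Rightarrow> 'a \<Rightarrow> bool" (infix \<open>\<sqsubseteq>\<index>\<close> 50)
  where "a \<sqsubseteq>\<^bsub>L\<^esub> b \<longleftrightarrow> a \<squnion>\<^bsub>L\<^esub> b = b"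

locale bounded_distributive_lattice =
  fixes L :: "('a, 'm) cha_structure_scheme" (structure)
  assumes zero_closed: "\<zero> \<in> carrier L"
    and one_closed: "\<one> \<in> carrier L"
    and join_closed: "\<lbrakk>a \<in> carrier L; b \<in> carrier L\<rbrakk> \<Longrightarrow> a \<squnion> b \<in> carrier L"
    and meet_closed: "\<lbrakk>a \<in> carrier L; b \<in> carrier L\<rbrakk> \<Longrightarrow> a \<sqinter> b \<in> carrier L"
    and join_assoc: "\<lbrakk>a \<in> carrier L; b \<in> carrier L; c \<in> carrier L\<rbrakk> \<Longrightarrow> (a \<squnion> b) \<squnion> c = a \<squnion> (b \<squnion> c)"
    and meet_assoc: "\<lbrakk>a \<in> carrier L; b \<in> carrier L; c \<in> carrier L\<rbrakk> \<Longrightarrow> (a \<sqinter> b) \<sqinter> c = a \<sqinter> (b \<sqinter> c)"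
    and join_comm: "\<lbrakk>a \<in> carrier L; b \<in> carrier L\<rbrakk> \<Longrightarrow> a \<squnion> b = b \<squnion> a"
    and meet_comm: "\<lbrakk>a \<in> carrier L; b \<in> carrier L\<rbrakk> \<Longrightarrow> a \<sqinter> b = b \<sqinter> a"
    and join_absorb: "\<lbrakk>a \<in> carrier L; b \<in> carrier L\<rbrakk> \<Longrightarrow> a \<squnion> (a \<sqinter> b) = a"
    and meet_absorb: "\<lbrakk>a \<in> carrier L; b \<in> carrier L\<rbrakk> \<Longrightarrow> a \<sqinter> (a \<squnion> b) = a"
    and meet_join_distrib:
      "\<lbrakk>a \<in> carrier L; b \<in> carrier L; c \<in> carrier L\<rbrakk> \<Longrightarrow> a \<sqinter> (b \<squnion> c) = (a \<sqinter> b) \<squnion> (a \<sqinter> c)"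
    and zero_least: "a \<in> carrier L \<Longrightarrow> \<zero> \<sqsubseteq> a"
    and one_greatest: "a \<in> carrier L \<Longrightarrow> a \<sqsubseteq> \<one>"

locale co_heyting_algebra = bounded_distributive_lattice +
  assumes diff_closed: "\<lbrakk>a \<in> carrier L; b \<in> carrier L\<rbrakk> \<Longrightarrow> a \<ominus> b \<in> carrier L"
    and diff_upper: "\<lbrakk>a \<in> carrier L; b \<in> carrier L\<rbrakk> \<Longrightarrow> a \<sqsubseteq> b \<squnion> (a \<ominus> b)"
    and diff_least:
      "\<lbrakk>a \<in> carrier L; b \<in> carrier L; c \<in> carrier L; a \<sqsubseteq> b \<squnion> c\<rbrakk> \<Longrightarrow> a \<ominus> b \<sqsubseteq> c"

definition cha_embedding ::
  "('a \<Rightarrow> 'b) \<Rightarrow> 'a cha_structure \<Rightarrow> 'b cha_structure \<Rightarrow> bool"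
  where "cha_embedding f L M \<longleftrightarrow>
    f ` carrier L \<subseteq> carrier M \<and> inj_on f (carrier L) \<and>
    f \<zero>\<^bsub>L\<^esub> = \<zero>\<^bsub>M\<^esub> \<and> f \<one>\<^bsub>L\<^esub> = \<one>\<^bsub>M\<^esub> \<and>
    (\<forall>a\<in>carrier L. \<forall>b\<in>carrier L.
      f (a \<squnion>\<^bsub>L\<^esub> b) = f a \<squnion>\<^bsub>M\<^esub> f b \<and>
      f (a \<sqinter>\<^bsub>L\<^esub> b) = f a \<sqinter>\<^bsub>M\<^esub> f b \<and>
      f (a \<ominus>\<^bsub>L\<^esub> b) = f a \<ominus>\<^bsub>M\<^esub> f b)"


section \<open>First-order formulas in the language of co-Heyting algebras\<close>

datatype tm = Var nat | Zero | One | Join tm tm | Meet tm tm | Diff tm tm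

datatype fm = Eq tm tm | Neg fm | And fm fm | Or fm fm | Ex nat fm | All nat fm

primrec tm_val :: "'a cha_structure \<Rightarrow> (nat \<Rightarrow> 'a) \<Rightarrow> tm \<Rightarrow> 'a" where
  "tm_val M v (Var i) = v i"
| "tm_val M v Zero = \<zero>\<^bsub>M\<^esub>"
| "tm_val M v One = \<one>\<^bsub>M\<^esub>"
| "tm_val M v (Join s t) = tm_val M v s \<squnion>\<^bsub>M\<^esub> tm_val M v t"
| "tm_val M v (Meet s t) = tm_val M v s \<sqinter>\<^bsub>M\<^esub> tm_val M v t"
| "tm_val M v (Diff s t) = tm_val M v s \<ominus>\<^bsub>M\<^esub> tm_val M v t"

primrec sat :: "'a cha_structure \<Rightarrow> (nat \<Rightarrow> 'a) \<Rightarrow> fm \<Rightarrow> bool" where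
  "sat M v (Eq s t) \<longleftrightarrow> tm_val M v s = tm_val M v t"
| "sat M v (Neg \<phi>) \<longleftrightarrow> \<not> sat M v \<phi>"
| "sat M v (And \<phi> \<psi>) \<longleftrightarrow> sat M v \<phi> \<and> sat M v \<psi>"
| "sat M v (Or \<phi> \<psi>) \<longleftrightarrow> sat M v \<phi> \<or> sat M v \<psi>"
| "sat M v (Ex i \<phi>) \<longleftrightarrow> (\<exists>x\<in>carrier M. sat M (v(i := x)) \<phi>)"
| "sat M v (All i \<phi>) \<longleftrightarrow> (\<forall>x\<in>carrier M. sat M (v(i := x)) \<phi>)"

primrec quantifier_free :: "fm \<Rightarrow> bool" where
  "quantifier_free (Eq s t) \<longleftrightarrow> True"
| "quantifier_free (Neg \<phi>) \<longleftrightarrow> quantifier_free \<phi>"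
| "quantifier_free (And \<phi> \<psi>) \<longleftrightarrow> quantifier_free \<phi> \<and> quantifier_free \<psi>"
| "quantifier_free (Or \<phi> \<psi>) \<longleftrightarrow> quantifier_free \<phi> \<and> quantifier_free \<psi>"
| "quantifier_free (Ex i \<phi>) \<longleftrightarrow> False"
| "quantifier_free (All i \<phi>) \<longleftrightarrow> False"

inductive existential :: "fm \<Rightarrow> bool" where
  existential_qf: "quantifier_free \<phi> \<Longrightarrow> existential \<phi>"
| existential_Ex: "existential \<phi> \<Longrightarrow> existential (Ex i \<phi>)"


section \<open>Existential closedness\<close>

text \<open>
  Parameters are the values in \<open>L\<close> of the free variables, and an extension of \<open>L\<close> is a
  co-Heyting algebra \<open>M\<close> together with an embedding of \<open>L\<close> into \<open>M\<close>.  HOL has no quantification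
  over types, so \<open>M\<close> lives on a subset of \<open>'a + nat\<close>.  This loses no extension: the witnesses
  of an existential formula together with \<open>L\<close> generate a subalgebra of cardinality at most that of
  \<open>'a + nat\<close>.  Theorem \<open>existentially_closedD\<close> below proves the property for
  extensions on an arbitrary type.
\<close>

definition existentially_closed :: "'a cha_structure \<Rightarrow> bool"
  where "existentially_closed L \<longleftrightarrow>
    (\<forall>(M :: ('a + nat) cha_structure) f \<phi> v.
      co_heyting_algebra M \<longrightarrow> cha_embedding f L M \<longrightarrow> existential \<phi> \<longrightarrow>
      (\<forall>i. v i \<in> carrier L) \<longrightarrow> sat M (f \<circ> v) \<phi> \<longrightarrow> sat L v \<phi>)"

lemma tm_val_closed:
  assumes "co_heyting_algebra M" "\<forall>i. v i \<in> carrier M"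
  shows "tm_val M v t \<in> carrier M"
proof -
  interpret co_heyting_algebra M by fact
  show ?thesis
    by (induction t)
      (simp_all add: assms zero_closed one_closed join_closed meet_closed diff_closed)
qed

lemma tm_val_embedding:
  assumes "co_heyting_algebra L" "cha_embedding f L M" "\<forall>i. v i \<in> carrier L"
  shows "tm_val M (f \<circ> v) t = f (tm_val L v t)"
  using assms tm_val_closed[OF assms(1,3)] by (induction t) (simp_all add: cha_embedding_def)

lemma sat_embedding_qf:
  assumes "co_heyting_algebra L" "cha_embedding f L M" "\<forall>i. v i \<in> carrier L" "quantifier_free \<phi>"
  shows "sat M (f \<circ> v) \<phi> \<longleftrightarrow> sat L v \<phi>"
  using assms(4)
proof (induction \<phi>)
  case (Eq s t)
  then show ?case
    using assms(2) tm_val_closed[OF assms(1,3)] inj_on_eq_iff[of f "carrier L"]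
    by (simp add: tm_val_embedding[OF assms(1-3)] cha_embedding_def del: o_apply)
qed auto

lemma sat_embedding_existential:
  assumes "co_heyting_algebra L" "cha_embedding f L M" "existential \<phi>"
    and "\<forall>i. v i \<in> carrier L" "sat L v \<phi>"
  shows "sat M (f \<circ> v) \<phi>"
  using assms(3-5)
proof (induction \<phi> arbitrary: v rule: existential.induct)
  case (existential_qf \<phi>)
  then show ?case using sat_embedding_qf[OF assms(1,2)] by blast
next
  case (existential_Ex \<phi> i)
  then obtain x where x: "x \<in> carrier L" "sat L (v(i := x)) \<phi>" by auto
  have "sat M (f \<circ> (v(i := x))) \<phi>"
    by (rule existential_Ex.IH[OF _ x(2)]) (simp add: existential_Ex.prems x(1))
  then have "sat M ((f \<circ> v)(i := f x)) \<phi>" by (simp add: fun_upd_comp)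
  moreover have "f x \<in> carrier M" using x(1) assms(2) by (auto simp: cha_embedding_def)
  ultimately show ?case unfolding sat.simps by blast
qed

lemma existential_witnesses:
  assumes "existential \<phi>" "\<forall>i. v i \<in> carrier M" "sat M v \<phi>"
  shows "\<exists>W. finite W \<and> W \<subseteq> carrier M \<and>
    (\<forall>N. co_heyting_algebra N \<longrightarrow> cha_embedding id N M \<longrightarrow> W \<subseteq> carrier N \<longrightarrow>
      (\<forall>i. v i \<in> carrier N) \<longrightarrow> sat N v \<phi>)"
  using assms
proof (induction \<phi> arbitrary: v rule: existential.induct)
  case (existential_qf \<phi>)
  have "sat N v \<phi>" if "co_heyting_algebra N" "cha_embedding id N M" "\<forall>i. v i \<in> carrier N" for N
    using sat_embedding_qf[OF that existential_qf(1)] existential_qf by simp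
  then show ?case by (intro exI[of _ "{}"]) blast
next
  case (existential_Ex \<phi> i)
  then obtain x where x: "x \<in> carrier M" "sat M (v(i := x)) \<phi>" by auto
  have "\<forall>j. (v(i := x)) j \<in> carrier M" using x existential_Ex.prems by simp
  then obtain W where W: "finite W" "W \<subseteq> carrier M"
    "\<And>N. co_heyting_algebra N \<Longrightarrow> cha_embedding id N M \<Longrightarrow> W \<subseteq> carrier N \<Longrightarrow>
      (\<forall>j. (v(i := x)) j \<in> carrier N) \<Longrightarrow> sat N (v(i := x)) \<phi>"
    using existential_Ex.IH[of "v(i := x)"] x(2) by blast
  have "sat N v (Ex i \<phi>)" if "co_heyting_algebra N" "cha_embedding id N M"
    "insert x W \<subseteq> carrier N" "\<forall>i. v i \<in> carrier N" for N
    using W(3)[OF that(1,2)] that(3,4) by (auto intro!: bexI[of _ x])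
  then show ?case
    using x(1) W(1,2) by (intro exI[of _ "insert x W"]) blast
qed

unbundle cardinal_syntax

primrec gen_stage :: "'a cha_structure \<Rightarrow> 'a set \<Rightarrow> nat \<Rightarrow> 'a set" where
  "gen_stage M X 0 = X"
| "gen_stage M X (Suc n) = gen_stage M X n \<union>
    (\<lambda>(a, b). a \<squnion>\<^bsub>M\<^esub> b) ` (gen_stage M X n \<times> gen_stage M X n) \<union>
    (\<lambda>(a, b). a \<sqinter>\<^bsub>M\<^esub> b) ` (gen_stage M X n \<times> gen_stage M X n) \<union>
    (\<lambda>(a, b). a \<ominus>\<^bsub>M\<^esub> b) ` (gen_stage M X n \<times> gen_stage M X n)"

lemma gen_stage_mono: "m \<le> n \<Longrightarrow> gen_stage M X m \<subseteq> gen_stage M X n"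
  by (rule lift_Suc_mono_le[of "gen_stage M X"]) auto

lemma gen_stage_closed:
  assumes "co_heyting_algebra M" "X \<subseteq> carrier M"
  shows "gen_stage M X n \<subseteq> carrier M"
proof -
  interpret co_heyting_algebra M by fact
  show ?thesis
  proof (induction n)
    case (Suc n)
    then show ?case
      by (auto intro!: join_closed meet_closed diff_closed)
  qed (use assms in auto)
qed

lemma gen_stage_card:
  assumes "infinite (UNIV :: 'c set)" "|X| \<le>o |UNIV :: 'c set|"
  shows "|gen_stage M X n| \<le>o |UNIV :: 'c set|"
proof (induction n)
  case (Suc n)
  have cinf: "Cinfinite |UNIV :: 'c set|"
    using assms(1) card_of_Card_order[of "UNIV :: 'c set"] by (simp add: cinfinite_def Field_card_of)
  have "|gen_stage M X n \<times> gen_stage M X n| \<le>o |UNIV :: 'c set|"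
    using card_of_Times_ordLeq_infinite_Field[OF _ Suc Suc card_of_Card_order] assms(1)
    by (simp add: Field_card_of)
  then have "|g ` (gen_stage M X n \<times> gen_stage M X n)| \<le>o |UNIV :: 'c set|" for g :: "'a \<times> 'a \<Rightarrow> 'a"
    using card_of_image ordLeq_transitive by blast
  then show ?case
    using Suc cinf by (auto intro!: Un_Cinfinite_bound)
qed (use assms in auto)

lemma substructure_co_heyting:
  assumes "co_heyting_algebra M" "X \<subseteq> carrier M" "\<zero>\<^bsub>M\<^esub> \<in> X" "\<one>\<^bsub>M\<^esub> \<in> X"
    and "\<And>a b. a \<in> X \<Longrightarrow> b \<in> X \<Longrightarrow> a \<squnion>\<^bsub>M\<^esub> b \<in> X \<and> a \<sqinter>\<^bsub>M\<^esub> b \<in> X \<and> a \<ominus>\<^bsub>M\<^esub> b \<in> X"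
  shows "co_heyting_algebra (M\<lparr>carrier := X\<rparr>)"
proof -
  interpret co_heyting_algebra M by fact
  have X: "x \<in> carrier M" if "x \<in> X" for x using that assms(2) by blast
  have le: "a \<sqsubseteq>\<^bsub>M\<lparr>carrier := X\<rparr>\<^esub> b \<longleftrightarrow> a \<sqsubseteq>\<^bsub>M\<^esub> b" for a b by (simp add: cha_le_def)
  show ?thesis
    by (unfold_locales;
        (simp add: le assms(3-5) X join_assoc meet_assoc join_absorb meet_absorb meet_join_distrib
          zero_least one_greatest diff_upper diff_least; fail)?;
        simp add: X join_comm meet_comm)
qed

definition transport :: "('a \<Rightarrow> 'b) \<Rightarrow> 'a cha_structure \<Rightarrow> 'b cha_structure"
  where "transport g N = (let h = inv_into (carrier N) g in
    \<lparr>carrier = g ` carrier N, zero = g \<zero>\<^bsub>N\<^esub>, one = g \<one>\<^bsub>N\<^esub>,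
     join = (\<lambda>x y. g (h x \<squnion>\<^bsub>N\<^esub> h y)),
     meet = (\<lambda>x y. g (h x \<sqinter>\<^bsub>N\<^esub> h y)),
     diff = (\<lambda>x y. g (h x \<ominus>\<^bsub>N\<^esub> h y))\<rparr>)"

lemma transport_embedding:
  "inj_on g (carrier N) \<Longrightarrow> cha_embedding g N (transport g N)"
  by (simp add: cha_embedding_def transport_def Let_def)

lemma transport_co_heyting:
  assumes "co_heyting_algebra N" "inj_on g (carrier N)"
  shows "co_heyting_algebra (transport g N)"
proof -
  interpret co_heyting_algebra N by fact
  let ?T = "transport g N"
  note closed = zero_closed one_closed join_closed meet_closed diff_closed
  have c: "carrier ?T = g ` carrier N" "\<zero>\<^bsub>?T\<^esub> = g \<zero>\<^bsub>N\<^esub>" "\<one>\<^bsub>?T\<^esub> = g \<one>\<^bsub>N\<^esub>"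
    by (simp_all add: transport_def Let_def)
  have ops: "g a \<squnion>\<^bsub>?T\<^esub> g b = g (a \<squnion>\<^bsub>N\<^esub> b)" "g a \<sqinter>\<^bsub>?T\<^esub> g b = g (a \<sqinter>\<^bsub>N\<^esub> b)"
    "g a \<ominus>\<^bsub>?T\<^esub> g b = g (a \<ominus>\<^bsub>N\<^esub> b)"
    if "a \<in> carrier N" "b \<in> carrier N" for a b
    using that assms(2) by (simp_all add: transport_def Let_def)
  have le: "g a \<sqsubseteq>\<^bsub>?T\<^esub> g b \<longleftrightarrow> a \<sqsubseteq>\<^bsub>N\<^esub> b" if "a \<in> carrier N" "b \<in> carrier N" for a b
    using that assms(2) by (simp add: cha_le_def ops inj_on_eq_iff closed)
  show ?thesis
    by (unfold_locales;
        (auto simp: c ops le closed join_assoc meet_assoc join_absorb meet_absorb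
          meet_join_distrib zero_least one_greatest diff_upper diff_least; fail)?;
        auto simp: c ops join_comm meet_comm)
qed

theorem existentially_closedD:
  fixes L :: "'a cha_structure" and M :: "'b cha_structure"
  assumes L: "co_heyting_algebra L" and ec: "existentially_closed L"
    and M: "co_heyting_algebra M" and f: "cha_embedding f L M"
    and ex: "existential \<phi>" and v: "\<forall>i. v i \<in> carrier L" and sat: "sat M (f \<circ> v) \<phi>"
  shows "sat L v \<phi>"
proof -
  have fv: "\<forall>i. (f \<circ> v) i \<in> carrier M" using f v by (auto simp: cha_embedding_def)
  obtain W where W: "finite W" "W \<subseteq> carrier M"
    "\<And>N. co_heyting_algebra N \<Longrightarrow> cha_embedding id N M \<Longrightarrow> W \<subseteq> carrier N \<Longrightarrow>
      (\<forall>i. (f \<circ> v) i \<in> carrier N) \<Longrightarrow> sat N (f \<circ> v) \<phi>"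
    using existential_witnesses[OF ex fv sat] by blast
  define X where "X = f ` carrier L \<union> W"
  define G where "G = (\<Union>n. gen_stage M X n)"
  define N where "N = M\<lparr>carrier := G\<rparr>"
  have X: "X \<subseteq> carrier M" using W f by (auto simp: X_def cha_embedding_def)
  have XG: "X \<subseteq> G" by (auto simp: G_def intro!: exI[of _ 0])
  have GM: "G \<subseteq> carrier M" unfolding G_def using gen_stage_closed[OF M X] by blast
  have op: "a \<squnion>\<^bsub>M\<^esub> b \<in> G \<and> a \<sqinter>\<^bsub>M\<^esub> b \<in> G \<and> a \<ominus>\<^bsub>M\<^esub> b \<in> G" if ab: "a \<in> G" "b \<in> G" for a b
  proof -
    obtain m n where "a \<in> gen_stage M X m" "b \<in> gen_stage M X n"
      using ab by (auto simp: G_def)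
    then have "a \<in> gen_stage M X (max m n)" "b \<in> gen_stage M X (max m n)"
      using gen_stage_mono[of m "max m n" M X] gen_stage_mono[of n "max m n" M X] by auto
    then have "{a \<squnion>\<^bsub>M\<^esub> b, a \<sqinter>\<^bsub>M\<^esub> b, a \<ominus>\<^bsub>M\<^esub> b} \<subseteq> gen_stage M X (Suc (max m n))"
      unfolding gen_stage.simps by (auto simp: image_iff)
    then show ?thesis unfolding G_def by blast
  qed
  have bounds: "\<zero>\<^bsub>M\<^esub> \<in> X" "\<one>\<^bsub>M\<^esub> \<in> X"
  proof -
    interpret L: co_heyting_algebra L by fact
    have "f \<zero>\<^bsub>L\<^esub> \<in> X" "f \<one>\<^bsub>L\<^esub> \<in> X"
      using L.zero_closed L.one_closed by (simp_all add: X_def)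
    then show "\<zero>\<^bsub>M\<^esub> \<in> X" "\<one>\<^bsub>M\<^esub> \<in> X" using f by (simp_all add: cha_embedding_def)
  qed
  have N: "co_heyting_algebra N"
    unfolding N_def by (rule substructure_co_heyting[OF M GM]) (use bounds XG op in auto)
  have NM: "cha_embedding id N M" using GM by (simp add: N_def cha_embedding_def)
  have LN: "cha_embedding f L N" using f XG by (auto simp: N_def cha_embedding_def X_def)
  have "sat N (f \<circ> v) \<phi>"
    by (rule W(3)[OF N NM]) (use XG v in \<open>auto simp: N_def X_def\<close>)
  have inf: "infinite (UNIV :: ('a + nat) set)"
    by simp
  have cinf: "Cinfinite |UNIV :: ('a + nat) set|"
    using inf card_of_Card_order[of "UNIV :: ('a + nat) set"]
    by (simp add: cinfinite_def Field_card_of)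
  have "|f ` carrier L| \<le>o |UNIV :: ('a + nat) set|"
  proof -
    have "|f ` carrier L| \<le>o |carrier L|" by (rule card_of_image)
    moreover have "|carrier L| \<le>o |UNIV :: ('a + nat) set|"
      by (rule card_of_ordLeqI[of Inl]) auto
    ultimately show ?thesis using ordLeq_transitive by blast
  qed
  moreover have "|W| \<le>o |UNIV :: ('a + nat) set|"
  proof -
    obtain h :: "'b \<Rightarrow> nat" where "inj_on h W"
      using finite_imp_inj_to_nat_seg[OF W(1)] by blast
    then show ?thesis by (intro card_of_ordLeqI[of "Inr \<circ> h"]) (auto intro!: comp_inj_on)
  qed
  ultimately have "|X| \<le>o |UNIV :: ('a + nat) set|"
    unfolding X_def using cinf by (intro Un_Cinfinite_bound)
  then have "|gen_stage M X n| \<le>o |UNIV :: ('a + nat) set|" for n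
    by (rule gen_stage_card[OF inf])
  moreover have "|UNIV :: nat set| \<le>o |UNIV :: ('a + nat) set|"
    by (rule card_of_ordLeqI[of Inr]) auto
  ultimately have "|G| \<le>o |UNIV :: ('a + nat) set|"
    unfolding G_def using cinf by (intro UNION_Cinfinite_bound) auto
  then obtain g :: "'b \<Rightarrow> 'a + nat" where g: "inj_on g G"
    by (auto simp flip: card_of_ordLeq)
  then have gN: "inj_on g (carrier N)" by (simp add: N_def)
  let ?T = "transport g N"
  have NT: "cha_embedding g N ?T" by (rule transport_embedding[OF gN])
  have "sat ?T (g \<circ> (f \<circ> v)) \<phi>"
    by (rule sat_embedding_existential[OF N NT ex])
      (use LN v \<open>sat N (f \<circ> v) \<phi>\<close> in \<open>auto simp: cha_embedding_def\<close>)
  moreover have "cha_embedding (g \<circ> f) L ?T"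
    using LN NT unfolding cha_embedding_def
    by (simp add: image_subset_iff comp_inj_on inj_on_subset[of g "carrier N"])
  ultimately show ?thesis
    using ec[unfolded existentially_closed_def, rule_format, of ?T "g \<circ> f" \<phi> v]
      transport_co_heyting[OF N gN] ex v
    by (simp add: comp_assoc)
qed


section \<open>Density and splitting\<close>

definition strongly_below ::
  "('a, 'm) cha_structure_scheme \<Rightarrow> 'a \<Rightarrow> 'a \<Rightarrow> bool" (infix \<open>\<lless>\<index>\<close> 50)
  where "b \<lless>\<^bsub>L\<^esub> a \<longleftrightarrow> a \<ominus>\<^bsub>L\<^esub> b = a \<and> b \<sqsubseteq>\<^bsub>L\<^esub> a"

definition density_D1 :: "'a cha_structure \<Rightarrow> bool"
  where "density_D1 L \<longleftrightarrow>
    (\<forall>a\<in>carrier L. \<forall>c\<in>carrier L. c \<lless>\<^bsub>L\<^esub> a \<and> a \<noteq> \<zero>\<^bsub>L\<^esub> \<longrightarrow>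
      (\<exists>b\<in>carrier L. b \<noteq> \<zero>\<^bsub>L\<^esub> \<and> c \<lless>\<^bsub>L\<^esub> b \<and> b \<lless>\<^bsub>L\<^esub> a))"

definition splitting_S1 :: "'a cha_structure \<Rightarrow> bool"
  where "splitting_S1 L \<longleftrightarrow>
    (\<forall>a\<in>carrier L. \<forall>b1\<in>carrier L. \<forall>b2\<in>carrier L.
      b1 \<squnion>\<^bsub>L\<^esub> b2 \<lless>\<^bsub>L\<^esub> a \<and> a \<noteq> \<zero>\<^bsub>L\<^esub> \<longrightarrow>
      (\<exists>a1\<in>carrier L. \<exists>a2\<in>carrier L. a1 \<noteq> \<zero>\<^bsub>L\<^esub> \<and> a2 \<noteq> \<zero>\<^bsub>L\<^esub> \<and>
        a \<ominus>\<^bsub>L\<^esub> a2 = a1 \<and> b1 \<sqsubseteq>\<^bsub>L\<^esub> a1 \<and>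
        a \<ominus>\<^bsub>L\<^esub> a1 = a2 \<and> b2 \<sqsubseteq>\<^bsub>L\<^esub> a2 \<and>
        a1 \<sqinter>\<^bsub>L\<^esub> a2 = b1 \<sqinter>\<^bsub>L\<^esub> b2))"

end

theory Submission imports Defs begin

text \<open>
  A co-Heyting algebra \<open>L\<close> embeds into the algebra of up-sets of its spectrum \<open>X\<close>, the prime ideals
  ordered by reverse inclusion, and hence into the up-sets of every preorder \<open>Y\<close> with a surjective
  p-morphism onto \<open>X\<close>.  In both cases \<open>Y\<close> consists of two copies of each point of \<open>X\<close>.  For density
  the second copy lies above the first, except that the two are equivalent over \<open>c\<close>; the
  second copy of \<open>a\<close> together with \<open>c\<close> is then strictly between \<open>c\<close> and \<open>a\<close>.  For splitting the two
  copies carry two colours, the points over exactly one of \<open>b1\<close>, \<open>b2\<close> are forced to have the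
  corresponding colour, and points of different colours are comparable only over \<open>b1 \<sqinter> b2\<close>; the two
  colour classes over \<open>a\<close>, each together with \<open>b1 \<sqinter> b2\<close>, split \<open>a\<close>.  Existential closedness pulls
  these witnesses back to \<open>L\<close>.
\<close>

section \<open>Order in a bounded distributive lattice\<close>

context bounded_distributive_lattice
begin

lemmas lattice_closed = zero_closed one_closed join_closed meet_closed

lemma le_iff_meet:
  assumes "a \<in> carrier L" "b \<in> carrier L"
  shows "a \<sqsubseteq> b \<longleftrightarrow> a \<sqinter> b = a"
  using assms unfolding cha_le_def by (metis join_absorb join_comm meet_absorb meet_comm)

lemma le_refl: "a \<in> carrier L \<Longrightarrow> a \<sqsubseteq> a"
  unfolding cha_le_def by (metis join_absorb meet_absorb join_closed)

lemma le_trans: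
  assumes "a \<in> carrier L" "b \<in> carrier L" "c \<in> carrier L" "a \<sqsubseteq> b" "b \<sqsubseteq> c"
  shows "a \<sqsubseteq> c"
  using assms unfolding cha_le_def by (metis join_assoc)

lemma le_antisym:
  assumes "a \<in> carrier L" "b \<in> carrier L" "a \<sqsubseteq> b" "b \<sqsubseteq> a"
  shows "a = b"
  using assms unfolding cha_le_def by (metis join_comm)

lemma join_upper1: "\<lbrakk>a \<in> carrier L; b \<in> carrier L\<rbrakk> \<Longrightarrow> a \<sqsubseteq> a \<squnion> b"
  by (simp add: le_iff_meet join_closed meet_absorb)

lemma join_upper2: "\<lbrakk>a \<in> carrier L; b \<in> carrier L\<rbrakk> \<Longrightarrow> b \<sqsubseteq> a \<squnion> b"
  by (metis join_upper1 join_comm)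

lemma join_least:
  assumes "a \<in> carrier L" "b \<in> carrier L" "c \<in> carrier L" "a \<sqsubseteq> c" "b \<sqsubseteq> c"
  shows "a \<squnion> b \<sqsubseteq> c"
  using assms unfolding cha_le_def by (metis join_assoc)

lemma meet_lower1: "\<lbrakk>a \<in> carrier L; b \<in> carrier L\<rbrakk> \<Longrightarrow> a \<sqinter> b \<sqsubseteq> a"
  unfolding cha_le_def by (metis join_absorb join_comm meet_closed)

lemma meet_lower2: "\<lbrakk>a \<in> carrier L; b \<in> carrier L\<rbrakk> \<Longrightarrow> a \<sqinter> b \<sqsubseteq> b"
  by (metis meet_lower1 meet_comm)

lemma meet_greatest:
  assumes "a \<in> carrier L" "b \<in> carrier L" "c \<in> carrier L" "c \<sqsubseteq> a" "c \<sqsubseteq> b"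
  shows "c \<sqsubseteq> a \<sqinter> b"
  using assms by (simp add: le_iff_meet meet_closed) (metis meet_assoc)

lemma join_mono:
  assumes "a \<in> carrier L" "b \<in> carrier L" "c \<in> carrier L" "d \<in> carrier L" "a \<sqsubseteq> b" "c \<sqsubseteq> d"
  shows "a \<squnion> c \<sqsubseteq> b \<squnion> d"
  by (meson assms join_least le_trans join_upper1 join_upper2 join_closed)

text \<open>Expanding the right-hand side by the assumed distributive law leaves terms that absorb.
  The dual law is what yields primality in \<open>prime_ideal_separation\<close>.\<close>

lemma join_meet_distrib:
  assumes "a \<in> carrier L" "b \<in> carrier L" "c \<in> carrier L"
  shows "a \<squnion> (b \<sqinter> c) = (a \<squnion> b) \<sqinter> (a \<squnion> c)"
proof -
  have "(a \<squnion> b) \<sqinter> (a \<squnion> c) = ((a \<squnion> b) \<sqinter> a) \<squnion> ((a \<squnion> b) \<sqinter> c)"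
    using assms by (simp add: meet_join_distrib join_closed)
  also have "(a \<squnion> b) \<sqinter> a = a"
    using assms by (metis meet_absorb meet_comm join_closed)
  also have "(a \<squnion> b) \<sqinter> c = (a \<sqinter> c) \<squnion> (b \<sqinter> c)"
    using assms by (metis meet_comm meet_join_distrib join_closed)
  also have "a \<squnion> ((a \<sqinter> c) \<squnion> (b \<sqinter> c)) = a \<squnion> (b \<sqinter> c)"
    using assms by (metis join_assoc join_absorb meet_closed)
  finally show ?thesis by simp
qed


section \<open>Prime ideals\<close>

definition ideal :: "'a set \<Rightarrow> bool"
  where "ideal J \<longleftrightarrow> J \<subseteq> carrier L \<and> \<zero> \<in> J \<and>
    (\<forall>x\<in>J. \<forall>y\<in>J. x \<squnion> y \<in> J) \<and> (\<forall>x\<in>carrier L. \<forall>y\<in>J. x \<sqsubseteq> y \<longrightarrow> x \<in> J)"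

definition prime_ideal :: "'a set \<Rightarrow> bool"
  where "prime_ideal J \<longleftrightarrow> ideal J \<and> \<one> \<notin> J \<and>
    (\<forall>x\<in>carrier L. \<forall>y\<in>carrier L. x \<sqinter> y \<in> J \<longrightarrow> x \<in> J \<or> y \<in> J)"

lemma ideal_carrier: "\<lbrakk>ideal J; x \<in> J\<rbrakk> \<Longrightarrow> x \<in> carrier L"
  unfolding ideal_def by blast

lemma ideal_join: "\<lbrakk>ideal J; x \<in> J; y \<in> J\<rbrakk> \<Longrightarrow> x \<squnion> y \<in> J"
  unfolding ideal_def by blast

lemma ideal_downward: "\<lbrakk>ideal J; x \<in> carrier L; y \<in> J; x \<sqsubseteq> y\<rbrakk> \<Longrightarrow> x \<in> J"
  unfolding ideal_def by blast

text \<open>\<open>K\<close> is the ideal generated by \<open>J\<close> and \<open>b\<close>. It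
  serves both the maximality argument for prime ideals and the description of
  \<open>a \<ominus> b\<close> in the spectrum.\<close>

lemma ideal_extend:
  assumes J: "ideal J" and b: "b \<in> carrier L"
  defines "K \<equiv> {x \<in> carrier L. \<exists>j\<in>J. x \<sqsubseteq> b \<squnion> j}"
  shows "ideal K" "J \<subseteq> K" "b \<in> K"
proof -
  note c = ideal_carrier[OF J]
  show "J \<subseteq> K" unfolding K_def using c b join_upper2 by blast
  have z: "\<zero> \<in> J" using J by (simp add: ideal_def)
  show "b \<in> K" unfolding K_def using z b join_upper1 zero_closed by blast
  have "x \<squnion> y \<in> K" if "x \<in> K" "y \<in> K" for x y
  proof -
    from that obtain i j where ij: "i \<in> J" "j \<in> J" "x \<sqsubseteq> b \<squnion> i" "y \<sqsubseteq> b \<squnion> j"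
      and xy: "x \<in> carrier L" "y \<in> carrier L" unfolding K_def by blast
    note ijc = c[OF ij(1)] c[OF ij(2)]
    have "b \<squnion> i \<sqsubseteq> b \<squnion> (i \<squnion> j)" "b \<squnion> j \<sqsubseteq> b \<squnion> (i \<squnion> j)"
      using b ijc by (simp_all add: join_mono le_refl join_upper1 join_upper2 join_closed)
    then have "x \<sqsubseteq> b \<squnion> (i \<squnion> j)" "y \<sqsubseteq> b \<squnion> (i \<squnion> j)"
      using le_trans[OF xy(1) _ _ ij(3)] le_trans[OF xy(2) _ _ ij(4)] b ijc
      by (simp_all add: join_closed)
    then have "x \<squnion> y \<sqsubseteq> b \<squnion> (i \<squnion> j)"
      using xy b ijc by (simp add: join_least join_closed)
    then show ?thesis unfolding K_def
      using ideal_join[OF J ij(1,2)] join_closed[OF xy] by blast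
  qed
  moreover have "x \<in> K" if "x \<in> carrier L" "y \<in> K" "x \<sqsubseteq> y" for x y
  proof -
    from that(2) obtain j where j: "j \<in> J" "y \<sqsubseteq> b \<squnion> j" and y: "y \<in> carrier L"
      unfolding K_def by blast
    have "x \<sqsubseteq> b \<squnion> j"
      using le_trans[OF that(1) y join_closed[OF b c[OF j(1)]] that(3) j(2)] .
    then show ?thesis using that(1) j(1) unfolding K_def by blast
  qed
  moreover have "K \<subseteq> carrier L" by (auto simp: K_def)
  ultimately show "ideal K"
    using \<open>J \<subseteq> K\<close> z unfolding ideal_def by blast
qed

text \<open>Zorn's lemma gives an ideal \<open>J\<close> maximal among those that contain
  \<open>I\<close> and omit \<open>a\<close>. If \<open>x\<close> and \<open>y\<close> were outside
  \<open>J\<close> but their meet inside, maximality would bound \<open>a\<close> by the join of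
  each with an element of \<open>J\<close>, and distributivity would force \<open>a\<close> into
  \<open>J\<close>.\<close>

lemma prime_ideal_separation:
  assumes I: "ideal I" and a: "a \<in> carrier L" "a \<notin> I"
  obtains J where "prime_ideal J" "I \<subseteq> J" "a \<notin> J"
proof -
  let ?S = "{J. ideal J \<and> I \<subseteq> J \<and> a \<notin> J}"
  have "\<exists>U\<in>?S. \<forall>X\<in>C. X \<subseteq> U" if C: "subset.chain ?S C" for C
  proof (cases "C = {}")
    case True
    then show ?thesis using I a by auto
  next
    case False
    have CS: "ideal X" "I \<subseteq> X" "a \<notin> X" if "X \<in> C" for X
      using C that by (auto simp: subset_chain_def)
    have lin: "X \<subseteq> Z \<or> Z \<subseteq> X" if "X \<in> C" "Z \<in> C" for X Z
      using C that by (simp add: subset_chain_def)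
    have "x \<squnion> y \<in> \<Union>C" if xy: "x \<in> \<Union>C" "y \<in> \<Union>C" for x y
    proof -
      obtain X Z where XZ: "X \<in> C" "x \<in> X" "Z \<in> C" "y \<in> Z" using xy by blast
      then obtain W where W: "W \<in> C" "x \<in> W" "y \<in> W" using lin[of X Z] by blast
      then show ?thesis using ideal_join[OF CS(1)] by blast
    qed
    moreover have "\<Union>C \<subseteq> carrier L" using ideal_carrier CS(1) by blast
    moreover have "\<zero> \<in> \<Union>C" using False CS(1) unfolding ideal_def by blast
    moreover have "x \<in> \<Union>C" if "x \<in> carrier L" "y \<in> \<Union>C" "x \<sqsubseteq> y" for x y
      using that ideal_downward CS(1) by blast
    ultimately have "ideal (\<Union>C)" unfolding ideal_def by blast
    moreover have "I \<subseteq> \<Union>C" "a \<notin> \<Union>C" using False CS(2,3) by blast+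
    ultimately show ?thesis by blast
  qed
  from subset_Zorn[OF this] obtain J where JS: "J \<in> ?S" "\<forall>K\<in>?S. J \<subseteq> K \<longrightarrow> K = J" ..
  then have J: "ideal J" "I \<subseteq> J" "a \<notin> J" by simp_all
  have max: "K = J" if "ideal K" "I \<subseteq> K" "a \<notin> K" "J \<subseteq> K" for K
    using JS(2) that by simp
  note c = ideal_carrier[OF J(1)]
  \<comment> \<open>Otherwise the ideal generated by \<open>J\<close> and \<open>x\<close> omits
    \<open>a\<close>, so it equals \<open>J\<close> by maximality, although it contains
    \<open>x\<close>.\<close>
  have below: "\<exists>j\<in>J. a \<sqsubseteq> x \<squnion> j" if x: "x \<in> carrier L" "x \<notin> J" for x
  proof (rule ccontr)
    assume neg: "\<not> ?thesis"
    let ?K = "{y \<in> carrier L. \<exists>j\<in>J. y \<sqsubseteq> x \<squnion> j}"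
    have "?K = J"
    proof (rule max)
      show "I \<subseteq> ?K" using J(2) ideal_extend(2)[OF J(1) x(1)] by (rule subset_trans)
      show "a \<notin> ?K" using neg by blast
    qed (fact ideal_extend[OF J(1) x(1)])+
    then show False using ideal_extend(3)[OF J(1) x(1)] x(2) by simp
  qed
  have "x \<in> J \<or> y \<in> J" if x: "x \<in> carrier L" and y: "y \<in> carrier L" and xy: "x \<sqinter> y \<in> J" for x y
  proof (rule ccontr)
    assume "\<not> ?thesis"
    then obtain i j where ij: "i \<in> J" "j \<in> J" "a \<sqsubseteq> x \<squnion> i" "a \<sqsubseteq> y \<squnion> j"
      using below x y by blast
    \<comment> \<open>One element of \<open>J\<close> replaces both \<open>i\<close> and
      \<open>j\<close>, so that distributivity can combine the two bounds on
      \<open>a\<close>.\<close>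
    let ?k = "i \<squnion> j"
    have k: "?k \<in> J" by (rule ideal_join[OF J(1) ij(1,2)])
    have "a \<sqsubseteq> ?k \<squnion> z" if "z \<in> carrier L" "h \<in> J" "h \<sqsubseteq> ?k" "a \<sqsubseteq> z \<squnion> h" for z h
    proof -
      have "z \<squnion> h \<sqsubseteq> z \<squnion> ?k"
        using that c[OF k] c by (intro join_mono le_refl)
      then have "a \<sqsubseteq> z \<squnion> ?k"
        using that(1,4) le_trans[OF a(1) join_closed join_closed] c[OF that(2)] c[OF k] by blast
      then show ?thesis using join_comm[OF that(1) c[OF k]] by simp
    qed
    from this[OF x ij(1) _ ij(3)] this[OF y ij(2) _ ij(4)]
    have "a \<sqsubseteq> ?k \<squnion> x" "a \<sqsubseteq> ?k \<squnion> y"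
      using c[OF ij(1)] c[OF ij(2)] by (simp_all add: join_upper1 join_upper2)
    then have "a \<sqsubseteq> ?k \<squnion> (x \<sqinter> y)"
      using a x y c[OF k] by (simp add: join_meet_distrib meet_greatest join_closed)
    then show False
      using ideal_downward[OF J(1) a(1)] ideal_join[OF J(1) k xy] J(3) by blast
  qed
  moreover have "\<one> \<notin> J"
    using J(3) ideal_downward[OF J(1) a(1)] one_greatest[OF a(1)] by blast
  ultimately show thesis
    using J that[of J] unfolding prime_ideal_def by blast
qed

lemma prime_ideal_join:
  assumes "prime_ideal J" "x \<in> carrier L" "y \<in> carrier L"
  shows "x \<squnion> y \<in> J \<longleftrightarrow> x \<in> J \<and> y \<in> J"
  using assms unfolding prime_ideal_def
  by (meson ideal_join ideal_downward join_upper1 join_upper2)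

lemma prime_ideal_meet:
  assumes "prime_ideal J" "x \<in> carrier L" "y \<in> carrier L"
  shows "x \<sqinter> y \<in> J \<longleftrightarrow> x \<in> J \<or> y \<in> J"
  using assms unfolding prime_ideal_def
  by (meson ideal_downward meet_lower1 meet_lower2 meet_closed)

lemma prime_ideal_separates_le:
  assumes "a \<in> carrier L" "b \<in> carrier L" "\<not> a \<sqsubseteq> b"
  obtains J where "prime_ideal J" "b \<in> J" "a \<notin> J"
proof -
  have "ideal {x \<in> carrier L. x \<sqsubseteq> b}"
    using assms(2) zero_least lattice_closed
    unfolding ideal_def by (auto intro: join_least le_trans)
  from prime_ideal_separation[OF this assms(1)] assms show thesis
    using that le_refl by blast
qed

lemma prime_ideal_separates:
  assumes "a \<in> carrier L" "b \<in> carrier L" "a \<noteq> b"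
  obtains J where "prime_ideal J" "(a \<in> J) \<noteq> (b \<in> J)"
  using assms le_antisym prime_ideal_separates_le by metis

end

section \<open>Differences in the prime spectrum\<close>

context co_heyting_algebra
begin

text \<open>If \<open>a \<ominus> b\<close> is outside \<open>J\<close>, the ideal generated by
  \<open>J\<close> and \<open>b\<close> omits \<open>a\<close>, since
  \<open>a \<sqsubseteq> b \<squnion> j\<close> would put \<open>a \<ominus> b\<close> below
  \<open>j\<close>; separation then gives \<open>K\<close>. Conversely
  \<open>a \<sqsubseteq> b \<squnion> (a \<ominus> b)\<close> keeps \<open>a \<ominus> b\<close> out
  of \<open>K\<close>, hence out of \<open>J\<close>.\<close>

lemma prime_ideal_diff:
  assumes J: "prime_ideal J" and a: "a \<in> carrier L" and b: "b \<in> carrier L"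
  shows "a \<ominus> b \<notin> J \<longleftrightarrow> (\<exists>K. prime_ideal K \<and> J \<subseteq> K \<and> a \<notin> K \<and> b \<in> K)"
proof
  assume nJ: "a \<ominus> b \<notin> J"
  have iJ: "ideal J" using J by (simp add: prime_ideal_def)
  let ?I = "{x \<in> carrier L. \<exists>j\<in>J. x \<sqsubseteq> b \<squnion> j}"
  have "a \<notin> ?I"
    using nJ diff_least[OF a b] ideal_downward[OF iJ diff_closed[OF a b]] ideal_carrier[OF iJ] by blast
  then obtain K where "prime_ideal K" "?I \<subseteq> K" "a \<notin> K"
    using prime_ideal_separation[OF ideal_extend(1)[OF iJ b] a] by blast
  then show "\<exists>K. prime_ideal K \<and> J \<subseteq> K \<and> a \<notin> K \<and> b \<in> K"
    using ideal_extend(2,3)[OF iJ b] by blast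
next
  assume "\<exists>K. prime_ideal K \<and> J \<subseteq> K \<and> a \<notin> K \<and> b \<in> K"
  then obtain K where K: "prime_ideal K" "J \<subseteq> K" "a \<notin> K" "b \<in> K" by blast
  have "b \<squnion> (a \<ominus> b) \<notin> K"
    using K(1,3) diff_upper[OF a b] a unfolding prime_ideal_def by (meson ideal_downward)
  then show "a \<ominus> b \<notin> J"
    using K prime_ideal_join[OF K(1) b diff_closed[OF a b]] by blast
qed

end


section \<open>Up-sets of a preorder\<close>

text \<open>The difference is the up-closure of \<open>A - B\<close>, which for a preorder is the
  least up-set that covers \<open>A\<close> together with \<open>B\<close>.\<close>

definition up_set_algebra :: "'p set \<Rightarrow> ('p \<Rightarrow> 'p \<Rightarrow> bool) \<Rightarrow> 'p set cha_structure"
  where "up_set_algebra Y r =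
    \<lparr>carrier = {A. A \<subseteq> Y \<and> (\<forall>x\<in>A. \<forall>y\<in>Y. r x y \<longrightarrow> y \<in> A)}, zero = {}, one = Y,
     join = (\<union>), meet = (\<inter>), diff = (\<lambda>A B. {y \<in> Y. \<exists>x\<in>A - B. r x y})\<rparr>"

lemma up_set_algebra_simps [simp]:
  "carrier (up_set_algebra Y r) = {A. A \<subseteq> Y \<and> (\<forall>x\<in>A. \<forall>y\<in>Y. r x y \<longrightarrow> y \<in> A)}"
  "\<zero>\<^bsub>up_set_algebra Y r\<^esub> = {}"
  "\<one>\<^bsub>up_set_algebra Y r\<^esub> = Y"
  "A \<squnion>\<^bsub>up_set_algebra Y r\<^esub> B = A \<union> B"
  "A \<sqinter>\<^bsub>up_set_algebra Y r\<^esub> B = A \<inter> B"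
  "A \<ominus>\<^bsub>up_set_algebra Y r\<^esub> B = {y \<in> Y. \<exists>x\<in>A - B. r x y}"
  "A \<sqsubseteq>\<^bsub>up_set_algebra Y r\<^esub> B \<longleftrightarrow> A \<subseteq> B"
  by (auto simp: up_set_algebra_def cha_le_def)

lemma up_set_algebra_co_heyting:
  assumes "\<And>x. x \<in> Y \<Longrightarrow> r x x"
    and "\<And>x y z. \<lbrakk>x \<in> Y; y \<in> Y; z \<in> Y; r x y; r y z\<rbrakk> \<Longrightarrow> r x z"
  shows "co_heyting_algebra (up_set_algebra Y r)"
proof unfold_locales
  fix A B
  assume AB: "A \<in> carrier (up_set_algebra Y r)" "B \<in> carrier (up_set_algebra Y r)"
  then show "A \<ominus>\<^bsub>up_set_algebra Y r\<^esub> B \<in> carrier (up_set_algebra Y r)"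
    using assms(2) by simp blast
  show "A \<sqsubseteq>\<^bsub>up_set_algebra Y r\<^esub> B \<squnion>\<^bsub>up_set_algebra Y r\<^esub> (A \<ominus>\<^bsub>up_set_algebra Y r\<^esub> B)"
    using assms(1) AB by auto
qed auto

text \<open>The up-closure of \<open>A - B\<close> always lies in the up-set \<open>A\<close>, so
  equality only asks that it reach every point of \<open>A\<close>.\<close>

lemma up_set_strongly_below:
  assumes "A \<in> carrier (up_set_algebra Y r)"
  shows "B \<lless>\<^bsub>up_set_algebra Y r\<^esub> A \<longleftrightarrow> B \<subseteq> A \<and> (\<forall>y\<in>A. \<exists>x\<in>A - B. r x y)"
  using assms by (auto simp: strongly_below_def)


section \<open>Embeddings induced by p-morphisms onto the spectrum\<close>

text \<open>A surjective p-morphism \<open>g\<close> onto the prime ideals under reverse inclusion.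
  The back condition \<open>g_lift\<close> looks downwards, to larger ideals, because the difference
  of up-sets quantifies over points below.\<close>

locale spectrum_cover = co_heyting_algebra L
  for L :: "'a cha_structure" (structure) +
  fixes Y :: "'p set" and r :: "'p \<Rightarrow> 'p \<Rightarrow> bool" and g :: "'p \<Rightarrow> 'a set"
  assumes r_refl: "x \<in> Y \<Longrightarrow> r x x"
    and r_trans: "\<lbrakk>x \<in> Y; y \<in> Y; z \<in> Y; r x y; r y z\<rbrakk> \<Longrightarrow> r x z"
    and g_prime: "y \<in> Y \<Longrightarrow> prime_ideal (g y)"
    and g_mono: "\<lbrakk>x \<in> Y; y \<in> Y; r x y\<rbrakk> \<Longrightarrow> g y \<subseteq> g x"
    and g_surj: "prime_ideal J \<Longrightarrow> J \<in> g ` Y"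
    and g_lift: "\<lbrakk>y \<in> Y; prime_ideal K; g y \<subseteq> K\<rbrakk> \<Longrightarrow> \<exists>x\<in>Y. r x y \<and> g x = K"
begin

abbreviation U :: "'p set cha_structure"
  where "U \<equiv> up_set_algebra Y r"

text \<open>The preimage under \<open>g\<close> of the Stone map, which sends \<open>a\<close> to
  the prime ideals omitting it.\<close>

definition rep :: "'a \<Rightarrow> 'p set"
  where "rep a = {y \<in> Y. a \<notin> g y}"

lemma rep_closed: "rep a \<in> carrier U"
  using g_mono by (auto simp: rep_def)

text \<open>Injectivity combines prime separation with surjectivity of \<open>g\<close>. For
  differences, \<open>g_lift\<close> and \<open>g_mono\<close> carry the criterion of
  \<open>prime_ideal_diff\<close> from the spectrum to \<open>Y\<close> and back.\<close>

lemma rep_embedding: "cha_embedding rep L U"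
proof -
  have "inj_on rep (carrier L)"
  proof (rule inj_onI, rule ccontr)
    fix a b assume "a \<in> carrier L" "b \<in> carrier L" "rep a = rep b" "a \<noteq> b"
    then obtain J where "prime_ideal J" "(a \<in> J) \<noteq> (b \<in> J)"
      using prime_ideal_separates by metis
    then show False using g_surj \<open>rep a = rep b\<close> by (force simp: rep_def)
  qed
  moreover have "rep (a \<ominus> b) = rep a \<ominus>\<^bsub>U\<^esub> rep b"
    if ab: "a \<in> carrier L" "b \<in> carrier L" for a b
  proof (rule set_eqI)
    fix y
    show "y \<in> rep (a \<ominus> b) \<longleftrightarrow> y \<in> rep a \<ominus>\<^bsub>U\<^esub> rep b"
    proof (cases "y \<in> Y")
      case True
      have "(\<exists>K. prime_ideal K \<and> g y \<subseteq> K \<and> a \<notin> K \<and> b \<in> K) \<longleftrightarrow>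
          (\<exists>x\<in>Y. r x y \<and> a \<notin> g x \<and> b \<in> g x)"
        using g_prime g_mono[OF _ True] g_lift[OF True] by blast
      then show ?thesis
        using True prime_ideal_diff[OF g_prime[OF True] ab] by (auto simp: rep_def)
    qed (simp add: rep_def)
  qed
  moreover have "rep \<zero> = {}" "rep \<one> = Y"
    using g_prime by (auto simp: rep_def prime_ideal_def ideal_def)
  ultimately show ?thesis
    using rep_closed unfolding cha_embedding_def
    by (auto simp: rep_def prime_ideal_join prime_ideal_meet g_prime)
qed

lemma rep_nonempty:
  assumes "a \<in> carrier L" "a \<noteq> \<zero>"
  shows "rep a \<noteq> {}"
  using rep_embedding assms zero_closed unfolding cha_embedding_def
  by (auto dest: inj_onD)

lemma rep_join: "\<lbrakk>a \<in> carrier L; b \<in> carrier L\<rbrakk> \<Longrightarrow> rep (a \<squnion> b) = rep a \<union> rep b"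
  using rep_embedding unfolding cha_embedding_def by auto

lemma rep_strongly_below:
  assumes "a \<in> carrier L" "c \<in> carrier L" "c \<lless> a"
  shows "rep c \<lless>\<^bsub>U\<^esub> rep a"
  using rep_embedding assms unfolding cha_embedding_def strongly_below_def cha_le_def
  by metis

lemma existential_transfer:
  assumes "existentially_closed L" "existential \<phi>" "\<forall>i. v i \<in> carrier L"
    and "sat U (rep \<circ> v) \<phi>"
  shows "sat L v \<phi>"
  using existentially_closedD[OF _ assms(1) _ rep_embedding assms(2-4)]
    up_set_algebra_co_heyting[of Y r] r_refl r_trans co_heyting_algebra_axioms by blast

end


section \<open>Density and splitting\<close>

text \<open>The language has no order symbol, so the order is encoded as a join equation.\<close>

definition strongly_below_fm :: "tm \<Rightarrow> tm \<Rightarrow> fm"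
  where "strongly_below_fm s t = And (Eq (Diff t s) t) (Eq (Join s t) t)"

lemma sat_strongly_below_fm [simp]:
  "sat M v (strongly_below_fm s t) \<longleftrightarrow> tm_val M v s \<lless>\<^bsub>M\<^esub> tm_val M v t"
  by (simp add: strongly_below_fm_def strongly_below_def cha_le_def)

section \<open>Density by doubling the spectrum\<close>

lemma existentially_closed_density:
  fixes L :: "'a cha_structure"
  assumes L: "co_heyting_algebra L" and ec: "existentially_closed L"
  shows "density_D1 L"
proof -
  interpret co_heyting_algebra L by fact
  have "\<exists>b\<in>carrier L. b \<noteq> \<zero>\<^bsub>L\<^esub> \<and> c \<lless>\<^bsub>L\<^esub> b \<and> b \<lless>\<^bsub>L\<^esub> a"
    if a: "a \<in> carrier L" "a \<noteq> \<zero>\<^bsub>L\<^esub>" and c: "c \<in> carrier L" "c \<lless>\<^bsub>L\<^esub> a" for a c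
  proof -
    define Y :: "('a set \<times> bool) set" where "Y = {J. prime_ideal J} \<times> UNIV"
    \<comment> \<open>Going up, the flag may turn from False to True but not back, unless the upper
      point lies over \<open>c\<close>, where flags are ignored. Points over \<open>c\<close> form
      an up-set, which gives transitivity.\<close>
    define r :: "'a set \<times> bool \<Rightarrow> 'a set \<times> bool \<Rightarrow> bool"
      where "r x y \<longleftrightarrow> fst y \<subseteq> fst x \<and> (c \<notin> fst y \<or> (snd x \<longrightarrow> snd y))" for x y
    interpret spectrum_cover L Y r fst
    proof unfold_locales
      fix y :: "'a set \<times> bool" and K assume "y \<in> Y" "prime_ideal K" "fst y \<subseteq> K"
      \<comment> \<open>The flag False is allowed below either flag.\<close>
      then show "\<exists>x\<in>Y. r x y \<and> fst x = K"
        by (intro bexI[of _ "(K, False)"]) (auto simp: Y_def r_def)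
    next
      fix K assume "prime_ideal K"
      then show "K \<in> fst ` Y" by (simp add: Y_def)
    qed (auto simp: Y_def r_def)
    have Y_iff: "y \<in> Y \<longleftrightarrow> prime_ideal (fst y)" for y
      by (simp add: Y_def mem_Times_iff)
    have rep_iff: "y \<in> rep e \<longleftrightarrow> prime_ideal (fst y) \<and> e \<notin> fst y" for y e
      by (simp add: rep_def Y_iff)
    define B where "B = {y. prime_ideal (fst y) \<and> a \<notin> fst y \<and> (c \<notin> fst y \<or> snd y)}"
    have ca: "rep c \<lless>\<^bsub>U\<^esub> rep a"
      by (rule rep_strongly_below[OF a(1) c])
    then have ca_iff: "rep c \<subseteq> rep a" "\<forall>y\<in>rep a. \<exists>x\<in>rep a - rep c. r x y"
      unfolding up_set_strongly_below[OF rep_closed] by simp_all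
    \<comment> \<open>Membership in \<open>rep\<close> depends on the ideal alone, so the flag of
      the test point is arbitrary.\<close>
    have cJ: "a \<notin> J" if "prime_ideal J" "c \<notin> J" for J
      using subsetD[OF ca_iff(1), of "(J, True)"] that by (simp add: rep_iff Y_iff)
    have descend: "\<exists>K. prime_ideal K \<and> J \<subseteq> K \<and> a \<notin> K \<and> c \<in> K" if "prime_ideal J" "a \<notin> J" for J
    proof -
      have "(J, True) \<in> rep a" using that by (simp add: rep_iff Y_iff)
      then obtain x where "x \<in> rep a - rep c" "r x (J, True)" using ca_iff(2) by blast
      then show ?thesis by (intro exI[of _ "fst x"]) (auto simp: rep_iff Y_iff r_def)
    qed
    have B: "B \<in> carrier U"
      by (auto simp: B_def Y_iff r_def)
    have "B \<noteq> {}"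
      using rep_nonempty[OF a] by (auto simp: B_def rep_iff Y_iff)
    moreover have "rep c \<lless>\<^bsub>U\<^esub> B"
      unfolding up_set_strongly_below[OF B]
    proof (intro conjI ballI)
      show "rep c \<subseteq> B" using cJ by (auto simp: B_def rep_iff Y_iff)
      fix y assume "y \<in> B"
      moreover from this obtain K where "prime_ideal K" "fst y \<subseteq> K" "a \<notin> K" "c \<in> K"
        using descend[of "fst y"] by (auto simp: B_def)
      \<comment> \<open>The flag True keeps the new point in \<open>B\<close>, and it is allowed
        below \<open>y\<close> because \<open>y\<close> either has flag True or lies over
        \<open>c\<close>.\<close>
      ultimately show "\<exists>x\<in>B - rep c. r x y"
        by (intro bexI[of _ "(K, True)"]) (auto simp: B_def rep_iff r_def)
    qed
    moreover have "B \<lless>\<^bsub>U\<^esub> rep a"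
      unfolding up_set_strongly_below[OF rep_closed]
    proof (intro conjI ballI)
      show "B \<subseteq> rep a" by (auto simp: B_def rep_iff Y_iff)
      fix y assume "y \<in> rep a"
      then obtain K where "prime_ideal K" "fst y \<subseteq> K" "a \<notin> K" "c \<in> K"
        using descend[of "fst y"] by (auto simp: rep_iff Y_iff)
      \<comment> \<open>With \<open>c\<close> in \<open>K\<close>, the flag False excludes the point
        from \<open>B\<close>.\<close>
      then show "\<exists>x\<in>rep a - B. r x y"
        by (intro bexI[of _ "(K, False)"]) (auto simp: B_def rep_iff r_def Y_iff)
    qed
    ultimately have witness: "\<exists>b\<in>carrier U. b \<noteq> {} \<and> rep c \<lless>\<^bsub>U\<^esub> b \<and> b \<lless>\<^bsub>U\<^esub> rep a"
      using B by blast
    let ?\<phi> = "Ex 2 (And (Neg (Eq (Var 2) Zero))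
      (And (strongly_below_fm (Var 1) (Var 2)) (strongly_below_fm (Var 2) (Var 0))))"
    \<comment> \<open>Indices other than 0 default to \<open>c\<close>, so that every value lies in
      the carrier.\<close>
    let ?v = "\<lambda>i::nat. if i = 0 then a else c"
    have "sat L ?v ?\<phi>"
    proof (rule existential_transfer[OF ec])
      show "existential ?\<phi>"
        by (intro existential.intros) (simp add: strongly_below_fm_def)
      show "sat U (rep \<circ> ?v) ?\<phi>"
        using witness by (simp del: up_set_algebra_simps(1))
    qed (use a c in simp)
    then show ?thesis by simp
  qed
  then show ?thesis unfolding density_D1_def by blast
qed

section \<open>Splitting by colouring two copies of the spectrum\<close>

lemma existentially_closed_splitting:
  fixes L :: "'a cha_structure"
  assumes L: "co_heyting_algebra L" and ec: "existentially_closed L"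
  shows "splitting_S1 L"
proof -
  interpret co_heyting_algebra L by fact
  have "\<exists>a1\<in>carrier L. \<exists>a2\<in>carrier L. a1 \<noteq> \<zero>\<^bsub>L\<^esub> \<and> a2 \<noteq> \<zero>\<^bsub>L\<^esub> \<and>
        a \<ominus>\<^bsub>L\<^esub> a2 = a1 \<and> b1 \<sqsubseteq>\<^bsub>L\<^esub> a1 \<and>
        a \<ominus>\<^bsub>L\<^esub> a1 = a2 \<and> b2 \<sqsubseteq>\<^bsub>L\<^esub> a2 \<and>
        a1 \<sqinter>\<^bsub>L\<^esub> a2 = b1 \<sqinter>\<^bsub>L\<^esub> b2"
    if a: "a \<in> carrier L" "a \<noteq> \<zero>\<^bsub>L\<^esub>" and b: "b1 \<in> carrier L" "b2 \<in> carrier L"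
      and ba: "b1 \<squnion>\<^bsub>L\<^esub> b2 \<lless>\<^bsub>L\<^esub> a" for a b1 b2
  proof -
    \<comment> \<open>The flag is a free colour except over exactly one of \<open>b1\<close>,
      \<open>b2\<close>: there \<open>b1\<close> forces True and \<open>b2\<close> forces
      False.\<close>
    define colour :: "'a set \<times> bool \<Rightarrow> bool"
      where "colour x = (if b1 \<in> fst x \<longleftrightarrow> b2 \<in> fst x then snd x else b1 \<notin> fst x)" for x
    define common :: "'a set \<times> bool \<Rightarrow> bool"
      where "common x \<longleftrightarrow> b1 \<notin> fst x \<and> b2 \<notin> fst x" for x
    define Y :: "('a set \<times> bool) set" where "Y = {J. prime_ideal J} \<times> UNIV"
    define r :: "'a set \<times> bool \<Rightarrow> 'a set \<times> bool \<Rightarrow> bool"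
      where "r x y \<longleftrightarrow> fst y \<subseteq> fst x \<and> (common y \<or> colour x = colour y)" for x y
    interpret spectrum_cover L Y r fst
    proof unfold_locales
      fix y :: "'a set \<times> bool" and K assume "y \<in> Y" "prime_ideal K" "fst y \<subseteq> K"
      \<comment> \<open>If \<open>y\<close> is not common and \<open>K\<close> contains exactly one
        of \<open>b1\<close>, \<open>b2\<close>, then \<open>fst y\<close> contains exactly the same
        one, so the forced colours agree. If \<open>K\<close> contains both, the flag sets the
        colour.\<close>
      then show "\<exists>x\<in>Y. r x y \<and> fst x = K"
        by (intro bexI[of _ "(K, colour y)"])
          (auto simp: Y_def r_def colour_def common_def split: if_splits)
    next
      fix x y z :: "'a set \<times> bool" assume "r x y" "r y z"
      \<comment> \<open>Common points form an up-set, so if \<open>z\<close> is not common then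
        neither is \<open>y\<close>, and all three colours agree.\<close>
      then show "r x z" by (auto simp: r_def common_def)
    next
      fix K assume "prime_ideal K"
      then show "K \<in> fst ` Y" by (simp add: Y_def)
    qed (auto simp: Y_def r_def)
    have Y_iff: "y \<in> Y \<longleftrightarrow> prime_ideal (fst y)" for y
      by (simp add: Y_def mem_Times_iff)
    have rep_iff: "y \<in> rep e \<longleftrightarrow> prime_ideal (fst y) \<and> e \<notin> fst y" for y e
      by (simp add: rep_def Y_iff)
    define A where "A i = {x \<in> Y. a \<notin> fst x \<and> (common x \<or> colour x = i)}" for i
    have "rep (b1 \<squnion>\<^bsub>L\<^esub> b2) \<lless>\<^bsub>U\<^esub> rep a"
      by (rule rep_strongly_below[OF a(1) join_closed[OF b] ba])
    then have sub: "rep b1 \<union> rep b2 \<subseteq> rep a"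
      and desc: "\<forall>y\<in>rep a. \<exists>x\<in>rep a - (rep b1 \<union> rep b2). r x y"
      unfolding up_set_strongly_below[OF rep_closed] rep_join[OF b] by simp_all
    have below: "a \<notin> J" if "prime_ideal J" "b1 \<notin> J \<or> b2 \<notin> J" for J
      using subsetD[OF sub, of "(J, True)"] that by (simp add: rep_iff)
    have descend: "\<exists>K. prime_ideal K \<and> fst y \<subseteq> K \<and> a \<notin> K \<and> b1 \<in> K \<and> b2 \<in> K"
      if y: "y \<in> rep a" for y
    proof -
      obtain x where "x \<in> rep a - (rep b1 \<union> rep b2)" "r x y"
        using bspec[OF desc y] by blast
      then show ?thesis by (intro exI[of _ "fst x"]) (simp add: rep_iff r_def)
    qed
    have A: "A i \<in> carrier U" for i
      by (auto simp: A_def Y_iff r_def common_def)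
    have nonempty: "A i \<noteq> {}" for i
    proof -
      obtain y where "y \<in> rep a" using rep_nonempty[OF a] by blast
      then obtain K where "prime_ideal K" "a \<notin> K" "b1 \<in> K" "b2 \<in> K"
        using descend by blast
      \<comment> \<open>Both \<open>b1\<close> and \<open>b2\<close> lie in \<open>K\<close>, so its
        colour is free.\<close>
      then have "(K, i) \<in> A i" by (simp add: A_def Y_iff colour_def)
      then show ?thesis by blast
    qed
    \<comment> \<open>Removing the other class also removes the common points. The up-closure
      restores them, because below each lies a point of \<open>rep a\<close> whose ideal contains
      \<open>b1\<close> and \<open>b2\<close> and which can be given colour
      \<open>i\<close>.\<close>
    have diff: "rep a \<ominus>\<^bsub>U\<^esub> A (\<not> i) = A i" for i
    proof
      have "rep a - A (\<not> i) \<subseteq> A i" by (auto simp: A_def rep_iff Y_iff)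
      moreover have "\<forall>x\<in>A i. \<forall>y\<in>Y. r x y \<longrightarrow> y \<in> A i" using A[of i] by simp
      ultimately show "rep a \<ominus>\<^bsub>U\<^esub> A (\<not> i) \<subseteq> A i"
        unfolding up_set_algebra_simps by blast
      show "A i \<subseteq> rep a \<ominus>\<^bsub>U\<^esub> A (\<not> i)"
      proof
        fix y assume y: "y \<in> A i"
        then have ya: "y \<in> rep a" "y \<in> Y" by (simp_all add: A_def rep_iff Y_iff)
        show "y \<in> rep a \<ominus>\<^bsub>U\<^esub> A (\<not> i)"
        proof (cases "common y")
          case True
          obtain K where "prime_ideal K" "fst y \<subseteq> K" "a \<notin> K" "b1 \<in> K" "b2 \<in> K"
            using descend[OF ya(1)] by blast
          then have "(K, i) \<in> rep a - A (\<not> i)" "r (K, i) y"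
            using True by (auto simp: A_def rep_iff Y_iff colour_def r_def common_def)
          then show ?thesis using ya(2) unfolding up_set_algebra_simps by blast
        next
          case False
          then have "y \<in> rep a - A (\<not> i)" using y ya by (auto simp: A_def)
          then show ?thesis using ya(2) r_refl unfolding up_set_algebra_simps by blast
        qed
      qed
    qed
    \<comment> \<open>A point over \<open>b1\<close> is common or has forced colour True; dually for
      \<open>b2\<close>.\<close>
    have b_below: "rep b1 \<subseteq> A True" "rep b2 \<subseteq> A False"
      using below by (auto simp: A_def rep_iff Y_iff common_def colour_def)
    have inter: "A True \<inter> A False = rep b1 \<inter> rep b2"
      using below by (auto simp: A_def rep_iff Y_iff common_def)
    have witness: "\<exists>a1\<in>carrier U. \<exists>a2\<in>carrier U. a1 \<noteq> {} \<and> a2 \<noteq> {} \<and>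
        rep a \<ominus>\<^bsub>U\<^esub> a2 = a1 \<and> rep b1 \<union> a1 = a1 \<and>
        rep a \<ominus>\<^bsub>U\<^esub> a1 = a2 \<and> rep b2 \<union> a2 = a2 \<and> a1 \<inter> a2 = rep b1 \<inter> rep b2"
      using A nonempty diff[of True] diff[of False] b_below inter
      by (intro bexI[of _ "A True"] bexI[of _ "A False"])
        (simp_all add: subset_Un_eq del: up_set_algebra_simps)
    let ?\<phi> = "Ex 3 (Ex 4
      (And (Neg (Eq (Var 3) Zero)) (And (Neg (Eq (Var 4) Zero))
      (And (Eq (Diff (Var 0) (Var 4)) (Var 3)) (And (Eq (Join (Var 1) (Var 3)) (Var 3))
      (And (Eq (Diff (Var 0) (Var 3)) (Var 4)) (And (Eq (Join (Var 2) (Var 4)) (Var 4))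
      (Eq (Meet (Var 3) (Var 4)) (Meet (Var 1) (Var 2))))))))))"
    let ?v = "\<lambda>i::nat. if i = 0 then a else if i = 1 then b1 else b2"
    have "sat L ?v ?\<phi>"
    proof (rule existential_transfer[OF ec])
      show "existential ?\<phi>" by (intro existential.intros) simp
      show "sat U (rep \<circ> ?v) ?\<phi>"
        using witness by (simp del: up_set_algebra_simps(1,6))
    qed (use a b in simp)
    then show ?thesis by (simp add: cha_le_def)
  qed
  then show ?thesis unfolding splitting_S1_def by blast
qed

theorem theorem4p3:
  fixes L :: "'a cha_structure"
  assumes "co_heyting_algebra L"
    and "existentially_closed L"
  shows "density_D1 L \<and> splitting_S1 L"
  using existentially_closed_density[OF assms] existentially_closed_splitting[OF assms] ..

end
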